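(* Let $\phi$ be an inner function on the unit disc $\mathbb{D}$, and let $\alpha \in \mathbb{T}$. Define $\Phi(z_1,z_2) := \phi(z_1 z_2)$ for $(z_1,z_2) \in \mathbb{D}^2$. Then $$\mathcal{C}_\alpha(\Phi) = \bigcup_{\zeta \in \mathcal{C}_\alpha(\phi)} \{(z, \zeta \overline{z}) : z \in \mathbb{T}\}.$$
   Context: $\mathbb{D}^d = \{z \in \mathbb{C}^d : |z_j| < 1,\ j=1,\dots,d\}$ and $\mathbb{T}^d = \{\zeta \in \mathbb{C}^d : |\zeta_j| = 1,\ j=1,\dots,d\}$; $m_d$ is normalized Lebesgue measure on $\mathbb{T}^d$. A bounded holomorphic function $\phi : \mathbb{D}^d \to \mathbb{D}$ is inner if its non-tangential boundary values $\phi^*(\zeta)$, which exist for $m_d$-almost every $\zeta \in \mathbb{T}^d$, satisfy $|\phi^*(\zeta)| = 1$ for $m_d$-almost every $\zeta \in \mathbb{T}^d$. If $\phi$ is inner on $\mathbb{D}$, then $\Phi$ is inner on $\mathbb{D}^2$. For an inner function $f$ on $\mathbb{D}^d$ and $\alpha \in \mathbb{T}$, the unimodular level set is $\mathcal{C}_\alpha(f) = \operatorname{Clos}\{\zeta \in \mathbb{T}^d : \lim_{r \to 1^-} f(r\zeta) = \alpha\}$, with closure taken in $\mathbb{T}^d$. *)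

theory Defs
  imports "HOL-Complex_Analysis.Complex_Analysis"
begin

abbreviation unit_disc :: "complex set" where
  "unit_disc \<equiv> ball 0 1"

abbreviation unit_circle :: "complex set" where
  "unit_circle \<equiv> sphere 0 1"

text \<open>Normalized arc length; \<open>uniform_measure\<close> supplies the factor \<open>1 / (2 * pi)\<close>.\<close>

definition circle_measure :: "complex measure" where
  "circle_measure =
     distr (uniform_measure lborel {0..2 * pi}) (restrict_space borel unit_circle) cis"

definition stolz_region :: "real \<Rightarrow> complex \<Rightarrow> complex set" where
  "stolz_region M \<zeta> = {z \<in> unit_disc. dist z \<zeta> < M * (1 - norm z)}"

text \<open>For \<open>M > 1\<close> and \<open>\<zeta>\<close> on the circle, the region contains the radius ending at \<open>\<zeta>\<close>, so the
  filter below is nontrivial and the limit is unique.\<close>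

definition has_nontangential_limit ::
  "(complex \<Rightarrow> complex) \<Rightarrow> complex \<Rightarrow> complex \<Rightarrow> bool" where
  "has_nontangential_limit f \<zeta> w \<longleftrightarrow>
     (\<forall>M>1. (f \<longlongrightarrow> w) (at \<zeta> within stolz_region M \<zeta>))"

text \<open>Functions on the disc are total functions whose values off the disc play no role.
  Boundedness is implied by the range condition.\<close>

definition inner_function :: "(complex \<Rightarrow> complex) \<Rightarrow> bool" where
  "inner_function f \<longleftrightarrow>
     f holomorphic_on unit_disc \<and> f ` unit_disc \<subseteq> unit_disc \<and>
     (AE \<zeta> in circle_measure. \<exists>w. has_nontangential_limit f \<zeta> w \<and> norm w = 1)"

text \<open>The argument \<open>T\<close> is the torus on which the level set lives: \<open>unit_circle\<close> for functions on
  the disc, \<open>unit_circle \<times> unit_circle\<close> for functions on the bidisc. The closure is the one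
  relative to \<open>T\<close>.\<close>

definition unimodular_level_set ::
  "'a::real_normed_vector set \<Rightarrow> ('a \<Rightarrow> complex) \<Rightarrow> complex \<Rightarrow> 'a set" where
  "unimodular_level_set T f \<alpha> =
     top_of_set T closure_of {\<zeta> \<in> T. ((\<lambda>r::real. f (r *\<^sub>R \<zeta>)) \<longlongrightarrow> \<alpha>) (at_left 1)}"

end

theory Submission
  imports Defs
begin

text \<open>On the radius through \<open>(a, b)\<close> the function \<open>\<Phi>\<close> runs through the values of \<open>\<phi>\<close> on the
  radius through \<open>a * b\<close>, at squared parameter. Hence the set of points of the torus with radial
  limit \<open>\<alpha>\<close> is the image of \<open>unit_circle \<times> S\<close> under \<open>(z, x) \<mapsto> (z, x * cnj z)\<close>, where \<open>S\<close> is the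
  corresponding set for \<open>\<phi>\<close>. By compactness this map commutes with closures.\<close>

text \<open>Squaring and \<open>sqrt\<close> are mutually inverse on (0, 1), and both tend to 1 from
  below there, so each direction is a change of variable.\<close>

lemma tendsto_at_left_1_power2_iff:
  fixes f :: "real \<Rightarrow> 'a::topological_space"
  shows "((\<lambda>r. f (r\<^sup>2)) \<longlongrightarrow> a) (at_left 1) \<longleftrightarrow> (f \<longlongrightarrow> a) (at_left 1)"
proof
  \<comment> \<open>Positivity matters: for negative \<open>r\<close>, \<open>r\<^sup>2 < 1\<close>
    may fail, and \<open>(sqrt r)\<^sup>2\<close> is the absolute value of \<open>r\<close>.\<close>
  have near: "eventually (\<lambda>r::real. r \<in> {0<..<1}) (at_left 1)"
    by (rule eventually_at_left_real) simp
  have square: "filterlim (\<lambda>r::real. r\<^sup>2) (at_left 1) (at_left 1)"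
  proof (unfold filterlim_at, intro conjI)
    show "((\<lambda>r::real. r\<^sup>2) \<longlongrightarrow> 1) (at_left 1)"
      by (auto intro!: tendsto_eq_intros)
    show "\<forall>\<^sub>F r::real in at_left 1. r\<^sup>2 \<in> {..<1} \<and> r\<^sup>2 \<noteq> 1"
      using near by eventually_elim (auto simp: power_less_one_iff abs_square_eq_1)
  qed
  have root: "filterlim sqrt (at_left 1) (at_left 1)"
  proof (unfold filterlim_at, intro conjI)
    show "(sqrt \<longlongrightarrow> 1) (at_left 1)"
      by (auto intro!: tendsto_eq_intros)
    show "\<forall>\<^sub>F r in at_left 1. sqrt r \<in> {..<1} \<and> sqrt r \<noteq> 1"
      using near by eventually_elim auto
  qed
  show "((\<lambda>r. f (r\<^sup>2)) \<longlongrightarrow> a) (at_left 1)" if "(f \<longlongrightarrow> a) (at_left 1)"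
    using filterlim_compose[OF that square] .
  show "(f \<longlongrightarrow> a) (at_left 1)" if "((\<lambda>r. f (r\<^sup>2)) \<longlongrightarrow> a) (at_left 1)"
  proof (rule Lim_transform_eventually[OF filterlim_compose[OF that root]])
    show "\<forall>\<^sub>F r in at_left 1. f ((sqrt r)\<^sup>2) = f r"
      using near by eventually_elim auto
  qed
qed

text \<open>A closed \<open>T\<close> contains the closure of each of its subsets, so passing to the
  relative closure cuts nothing off.\<close>

lemma unimodular_level_set_eq_closure:
  assumes "closed T"
  shows "unimodular_level_set T f \<alpha> =
    closure {\<zeta> \<in> T. ((\<lambda>r::real. f (r *\<^sub>R \<zeta>)) \<longlongrightarrow> \<alpha>) (at_left 1)}"
    (is "_ = closure ?S")
proof -
  have "closure ?S \<subseteq> T"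
    using assms by (intro closure_minimal) auto
  moreover have "T \<inter> ?S = ?S"
    by auto
  ultimately show ?thesis
    by (simp add: unimodular_level_set_def closure_of_subtopology Int_absorb1)
qed

text \<open>The image of the compact closure is compact, hence closed in a Hausdorff space, which
  gives one inclusion; continuity gives the other.\<close>

lemma closure_image_compact:
  fixes f :: "'a::topological_space \<Rightarrow> 'b::t2_space"
  assumes "compact (closure S)" and "continuous_on (closure S) f"
  shows "closure (f ` S) = f ` closure S"
proof
  have "closed (f ` closure S)"
    using assms by (intro compact_imp_closed compact_continuous_image)
  then show "closure (f ` S) \<subseteq> f ` closure S"
    by (intro closure_minimal image_mono closure_subset)
  show "f ` closure S \<subseteq> closure (f ` S)"
    using assms(2) by (intro image_closure_subset) (auto intro: closure_subset[THEN subsetD])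
qed

theorem proposition4p1:
  fixes \<phi> :: "complex \<Rightarrow> complex" and \<Phi> :: "complex \<times> complex \<Rightarrow> complex" and \<alpha> :: complex
  assumes "inner_function \<phi>"
    and "\<alpha> \<in> unit_circle"
    and "\<And>z1 z2. (z1, z2) \<in> unit_disc \<times> unit_disc \<Longrightarrow> \<Phi> (z1, z2) = \<phi> (z1 * z2)"
  shows "unimodular_level_set (unit_circle \<times> unit_circle) \<Phi> \<alpha> =
    (\<Union>\<zeta>\<in>unimodular_level_set unit_circle \<phi> \<alpha>. {(z, \<zeta> * cnj z) | z. z \<in> unit_circle})"
proof -
  define S where "S = {\<zeta> \<in> unit_circle. ((\<lambda>r::real. \<phi> (r *\<^sub>R \<zeta>)) \<longlongrightarrow> \<alpha>) (at_left 1)}"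
  \<comment> \<open>On the torus \<open>h\<close> is inverse to
    \<open>(a, b) \<mapsto> (a, a * b)\<close>. With \<open>x\<close> fixed and \<open>z\<close>
    running over the circle, it traces the curve attached to \<open>x\<close> in the claimed
    union.\<close>
  define h :: "complex \<times> complex \<Rightarrow> complex \<times> complex"
    where "h = (\<lambda>(z, x). (z, x * cnj z))"
  have cancel: "z * cnj z = 1" "cnj z * z = 1" if "z \<in> unit_circle" for z
    using that by (simp_all add: complex_norm_square[symmetric] mult.commute)
  have radial: "((\<lambda>r::real. \<Phi> (r *\<^sub>R (a, b))) \<longlongrightarrow> \<alpha>) (at_left 1) \<longleftrightarrow>
      ((\<lambda>r::real. \<phi> (r *\<^sub>R (a * b))) \<longlongrightarrow> \<alpha>) (at_left 1)"
    if "a \<in> unit_circle" "b \<in> unit_circle" for a b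
  proof -
    have "\<forall>\<^sub>F r::real in at_left 1. r \<in> {0<..<1}"
      by (rule eventually_at_left_real) simp
    \<comment> \<open>For these \<open>r\<close> both coordinates lie in the open disc, where \<Phi>
      is given by \<phi>; each contributes one factor \<open>r\<close>.\<close>
    then have "\<forall>\<^sub>F r::real in at_left 1. \<Phi> (r *\<^sub>R (a, b)) = \<phi> (r\<^sup>2 *\<^sub>R (a * b))"
    proof eventually_elim
      case (elim r)
      then have "\<Phi> (r *\<^sub>R a, r *\<^sub>R b) = \<phi> (r *\<^sub>R a * r *\<^sub>R b)"
        using that by (intro assms(3)) auto
      then show ?case
        by (simp add: power2_eq_square)
    qed
    then have "((\<lambda>r::real. \<Phi> (r *\<^sub>R (a, b))) \<longlongrightarrow> \<alpha>) (at_left 1) \<longleftrightarrow>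
        ((\<lambda>r::real. \<phi> (r\<^sup>2 *\<^sub>R (a * b))) \<longlongrightarrow> \<alpha>) (at_left 1)"
      by (rule tendsto_cong)
    then show ?thesis
      using tendsto_at_left_1_power2_iff[of "\<lambda>r. \<phi> (r *\<^sub>R (a * b))"] by simp
  qed
  have "{p \<in> unit_circle \<times> unit_circle. ((\<lambda>r::real. \<Phi> (r *\<^sub>R p)) \<longlongrightarrow> \<alpha>) (at_left 1)} =
      h ` (unit_circle \<times> S)" (is "?L = _")
  proof (intro equalityI subsetI)
    fix p assume "p \<in> ?L"
    then obtain a b where p: "p = (a, b)" "a \<in> unit_circle" "b \<in> unit_circle"
      and "((\<lambda>r::real. \<phi> (r *\<^sub>R (a * b))) \<longlongrightarrow> \<alpha>) (at_left 1)"
      using radial by (cases p) auto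
    then have "a * b \<in> S"
      by (simp add: S_def norm_mult)
    \<comment> \<open>The second coordinate is recovered from \<open>a * b * cnj a = b\<close>, as
      \<open>a\<close> is unimodular.\<close>
    moreover have "p = h (a, a * b)"
      using p(1) cancel[OF p(2)] by (simp add: h_def mult.commute mult.left_commute)
    ultimately show "p \<in> h ` (unit_circle \<times> S)"
      using p(2) by blast
  next
    fix p assume "p \<in> h ` (unit_circle \<times> S)"
    then obtain z x where "p = h (z, x)" and z: "z \<in> unit_circle" and x: "x \<in> S"
      by blast
    then have p: "p = (z, x * cnj z)"
      by (simp add: h_def)
    have w: "x * cnj z \<in> unit_circle"
      using x z by (simp add: S_def norm_mult)
    \<comment> \<open>The coordinates of \<open>h (z, x)\<close> multiply to \<open>x\<close>, so
      \<open>radial\<close> reduces the limit of \<Phi> at \<open>p\<close> to that of \<phi> at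
      \<open>x\<close>.\<close>
    have zx: "z * (x * cnj z) = x"
      using cancel[OF z] by (simp add: mult.left_commute)
    show "p \<in> ?L"
      using radial[OF z w, unfolded zx] x z w unfolding p S_def by simp
  qed
  \<comment> \<open>The circle is already closed, so only the factor \<open>S\<close> grows.\<close>
  moreover have "closure (unit_circle \<times> S) = unit_circle \<times> closure S"
    by (simp add: closure_Times)
  moreover have "compact (unit_circle \<times> closure S)"
  proof -
    have "bounded S"
      by (rule bounded_subset[OF bounded_sphere[of 0 1]]) (auto simp: S_def)
    then show ?thesis
      by (intro compact_Times) auto
  qed
  moreover have "continuous_on A h" for A
    unfolding h_def case_prod_unfold by (intro continuous_intros)
  ultimately have "unimodular_level_set (unit_circle \<times> unit_circle) \<Phi> \<alpha> =
      h ` (unit_circle \<times> closure S)"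
    by (simp add: unimodular_level_set_eq_closure closed_Times closure_image_compact)
  also have "closure S = unimodular_level_set unit_circle \<phi> \<alpha>"
    by (simp add: unimodular_level_set_eq_closure S_def)
  finally show ?thesis
    \<comment> \<open>Slicing the image of the product by its second factor yields the
      union.\<close>
    by (auto simp: h_def)
qed

end
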